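(* Let $$J=\begin{pmatrix} b_0&a_0&0&0&\ldots\\ a_0&b_1&a_1&0&\ldots\\ 0&a_1&b_2&a_2&\ldots\\ \vdots&\vdots&\vdots&\vdots&\ddots\end{pmatrix}$$ be a complex Jacobi matrix, where $a_k,b_k\in\mathbb{C}$ and $a_k\neq 0$ for all $k\in\mathbb{Z}_+$, and let $\{p_n\}_{n=0}^\infty$ be the system of polynomials with $p_0=1$ and $$a_{n-1}p_{n-1}(\lambda)+b_np_n(\lambda)+a_np_{n+1}(\lambda)=\lambda p_n(\lambda),\qquad n\in\mathbb{Z}_+,$$ where $a_{-1}:=0$, $p_{-1}(\lambda):=0$. Suppose that there is $M>0$ such that $|a_k|\le M$ and $|b_k|\le M$ for all $k\in\mathbb{Z}_+$. Let $A_0$ be the operator on $l^2_{fin}$ associated to $J$. Let $\mu$ be a (non-negative) measure on $\mathfrak{B}(\mathbb{C})$ with compact support such that $S(p)=\int_{\mathbb{C}}p(\lambda)\,d\mu(\lambda)$ for all $p\in\mathbb{P}$, where $S$ is the linear functional associated to $J$. Let $T:l^2_{fin}\to L^2_\mu$ be the linear operator $$T\sum_{k=0}^d\xi_k\vec e_k=\left[\sum_{k=0}^d\xi_kp_k(z)\right],\qquad \xi_k\in\mathbb{C},\ d\in\mathbb{Z}_+.$$ Then $T$ is invertible (that is, injective, with inverse $T^{-1}$ defined on the range of $T$) and $$TA_0T^{-1}=\Lambda_0,$$ where $\Lambda_0=\Lambda_\mu|_{\mathcal{P}}$ (equality of operators, including equality of domains).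
   Context: $\mathbb{Z}_+$ is the set of non-negative integers, $\mathbb{P}$ is the set of all complex polynomials, and $\mathfrak{B}(\mathbb{C})$ is the set of all Borel subsets of $\mathbb{C}$. $l^2$ is the space of square-summable complex sequences $(u_k)_{k=0}^\infty$, $l^2_{fin}$ is the subset of all finite vectors (finitely many nonzero entries) in $l^2$, and $\vec e_k$ is the vector of $l^2$ having $1$ in the $k$-th place and zeros elsewhere ($k\in\mathbb{Z}_+$). The operator $A_0$ on $l^2_{fin}$ is given by matrix multiplication by $J$ (acting on column vectors). $L^2_\mu$ is the usual space of equivalence classes of Borel measurable functions $f:\mathbb{C}\to\mathbb{C}$ with $\int_{\mathbb{C}}|f|^2d\mu<+\infty$; $[f]$ denotes the class containing $f$. $\Lambda_\mu$ is the operator of multiplication by the independent variable, $[f(z)]\mapsto[zf(z)]$, in $L^2_\mu$, and $\mathcal{P}:=\{[p]:\ p\in\mathbb{P}\}\subseteq L^2_\mu$. The spectral function $\sigma(u,v)$, $u,v\in\mathbb{P}$, is the functional, linear in both arguments (complex bilinear, no conjugation), determined by $\sigma(p_n,p_m)=\delta_{n,m}$ for all $n,m\in\mathbb{Z}_+$ (note $\deg p_n=n$). The linear functional $S$ associated to $J$ is $S(u)=\sigma(u,1)$, $u\in\mathbb{P}$. *)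

theory Defs
  imports "HOL-Analysis.Analysis" "HOL-Computational_Algebra.Polynomial"
begin

definition jacobi_matrix :: "(nat \<Rightarrow> complex) \<Rightarrow> (nat \<Rightarrow> complex) \<Rightarrow> nat \<Rightarrow> nat \<Rightarrow> complex" where
  "jacobi_matrix a b i j =
     (if i = j then b i else if j = Suc i then a i else if i = Suc j then a j else 0)"

definition jacobi_polys ::
  "(nat \<Rightarrow> complex) \<Rightarrow> (nat \<Rightarrow> complex) \<Rightarrow> (nat \<Rightarrow> complex poly) \<Rightarrow> bool" where
  "jacobi_polys a b p \<longleftrightarrow>
     p 0 = 1 \<and>
     (\<forall>n x. (case n of 0 \<Rightarrow> 0 | Suc m \<Rightarrow> a m * poly (p m) x)
              + b n * poly (p n) x + a n * poly (p (Suc n)) x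
            = x * poly (p n) x)"

definition spectral_function ::
  "(nat \<Rightarrow> complex poly) \<Rightarrow> (complex poly \<Rightarrow> complex poly \<Rightarrow> complex) \<Rightarrow> bool" where
  "spectral_function p \<sigma> \<longleftrightarrow>
     (\<forall>v. Vector_Spaces.linear smult (*) (\<lambda>u. \<sigma> u v)) \<and>
     (\<forall>u. Vector_Spaces.linear smult (*) (\<lambda>v. \<sigma> u v)) \<and>
     (\<forall>n m. \<sigma> (p n) (p m) = (if n = m then 1 else 0))"

definition assoc_functional ::
  "(complex poly \<Rightarrow> complex poly \<Rightarrow> complex) \<Rightarrow> complex poly \<Rightarrow> complex" where
  "assoc_functional \<sigma> u = \<sigma> u 1"

definition l2 :: "(nat \<Rightarrow> complex) set" where
  "l2 = {u. summable (\<lambda>k. (norm (u k))\<^sup>2)}"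

definition l2_fin :: "(nat \<Rightarrow> complex) set" where
  "l2_fin = {u \<in> l2. finite {k. u k \<noteq> 0}}"

definition measure_support :: "'a::topological_space measure \<Rightarrow> 'a set" where
  "measure_support \<mu> = {z. \<forall>U. open U \<longrightarrow> z \<in> U \<longrightarrow> emeasure \<mu> U > 0}"

definition L2_fun :: "complex measure \<Rightarrow> (complex \<Rightarrow> complex) set" where
  "L2_fun \<mu> = {f \<in> borel_measurable borel. (\<integral>\<^sup>+z. ennreal ((norm (f z))\<^sup>2) \<partial>\<mu>) < \<infinity>}"

definition L2_rel :: "complex measure \<Rightarrow> (complex \<Rightarrow> complex) rel" where
  "L2_rel \<mu> = {(f, g). f \<in> L2_fun \<mu> \<and> g \<in> L2_fun \<mu> \<and> (AE z in \<mu>. f z = g z)}"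

(* The elements of L^2 are the members of the quotient L2_fun \<mu> // L2_rel \<mu>; the class
   below is meaningful only for representatives in L2_fun \<mu> and is empty otherwise. *)
definition L2_class :: "complex measure \<Rightarrow> (complex \<Rightarrow> complex) \<Rightarrow> (complex \<Rightarrow> complex) set" where
  "L2_class \<mu> f = L2_rel \<mu> `` {f}"

definition L2_polys :: "complex measure \<Rightarrow> (complex \<Rightarrow> complex) set set" where
  "L2_polys \<mu> = range (\<lambda>q. L2_class \<mu> (poly q))"

(* Operators with a domain are represented by their graphs, so equality of operators
   includes equality of domains.  The inverse of an injective operator is the converse of its
   graph.  Relational composition runs from left to right: the product B A is A O B. *)
definition op_on :: "'a set \<Rightarrow> ('a \<Rightarrow> 'b) \<Rightarrow> ('a \<times> 'b) set" where
  "op_on D f = {(x, f x) | x. x \<in> D}"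

definition op_restrict :: "('a \<times> 'b) set \<Rightarrow> 'a set \<Rightarrow> ('a \<times> 'b) set" where
  "op_restrict A D = {(x, y) \<in> A. x \<in> D}"

definition mat_vec :: "(nat \<Rightarrow> nat \<Rightarrow> complex) \<Rightarrow> (nat \<Rightarrow> complex) \<Rightarrow> nat \<Rightarrow> complex" where
  "mat_vec A u = (\<lambda>i. \<Sum>j. A i j * u j)"

definition A0_op ::
  "(nat \<Rightarrow> complex) \<Rightarrow> (nat \<Rightarrow> complex) \<Rightarrow> ((nat \<Rightarrow> complex) \<times> (nat \<Rightarrow> complex)) set" where
  "A0_op a b = op_on l2_fin (mat_vec (jacobi_matrix a b))"

definition T_map ::
  "(nat \<Rightarrow> complex poly) \<Rightarrow> complex measure \<Rightarrow> (nat \<Rightarrow> complex) \<Rightarrow> (complex \<Rightarrow> complex) set" where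
  "T_map p \<mu> u = L2_class \<mu> (\<lambda>z. \<Sum>k | u k \<noteq> 0. u k * poly (p k) z)"

definition T_op ::
  "(nat \<Rightarrow> complex poly) \<Rightarrow> complex measure \<Rightarrow> ((nat \<Rightarrow> complex) \<times> (complex \<Rightarrow> complex) set) set" where
  "T_op p \<mu> = op_on l2_fin (T_map p \<mu>)"

(* Maximal domain: the classes [f] such that both f and z f(z) are square integrable. *)
definition mult_op ::
  "complex measure \<Rightarrow> ((complex \<Rightarrow> complex) set \<times> (complex \<Rightarrow> complex) set) set" where
  "mult_op \<mu> = {(L2_class \<mu> f, L2_class \<mu> (\<lambda>z. z * f z)) | f.
                   f \<in> L2_fun \<mu> \<and> (\<lambda>z. z * f z) \<in> L2_fun \<mu>}"

end

theory Submission
  imports Defs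
begin

text \<open>
  Let \<open>P u = \<Sum>\<^sub>k u\<^sub>k p\<^sub>k\<close>, so that \<open>T u\<close> is the class of \<open>P u\<close>. The recurrence says
  \<open>P (J u) = x P u\<close>; since \<open>P e\<^sub>0 = 1\<close>, this already shows that \<open>P\<close> is onto the polynomials.
  Symmetry of \<open>J\<close> makes multiplication by \<open>x\<close> symmetric for \<open>\<sigma>\<close>, hence \<open>\<sigma>(q, r) = S(q r)\<close>
  and \<open>u\<^sub>m = \<sigma>(P u, p\<^sub>m) = \<integral> P u p\<^sub>m d\<mu>\<close>: the coefficients of \<open>u\<close> depend only on the class of \<open>P u\<close>.
\<close>

section \<open>Finite vectors and their polynomial expansions\<close>

definition poly_expansion :: "(nat \<Rightarrow> complex poly) \<Rightarrow> (nat \<Rightarrow> complex) \<Rightarrow> complex poly" where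
  "poly_expansion p u = (\<Sum>k | u k \<noteq> 0. smult (u k) (p k))"

text \<open>Replaces the support by an initial segment, so that sums over different vectors share an
  index set and can be swapped or compared.\<close>

lemma poly_expansion_eq_sum:
  assumes "\<forall>k\<ge>n. u k = 0"
  shows "poly_expansion p u = (\<Sum>k<n. smult (u k) (p k))"
  unfolding poly_expansion_def
  by (rule sum.mono_neutral_left) (use assms not_le in auto)

lemma smult_sum_right: "smult c (sum f A) = (\<Sum>i\<in>A. smult c (f i))"
  by (induction A rule: infinite_finite_induct) (simp_all add: smult_add_right)

lemma l2_fin_iff_finite: "u \<in> l2_fin \<longleftrightarrow> finite {k. u k \<noteq> 0}"
proof
  assume fin: "finite {k. u k \<noteq> 0}"
  have "summable (\<lambda>k. (norm (u k))\<^sup>2)"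
    by (rule summable_finite[OF fin]) auto
  with fin show "u \<in> l2_fin"
    by (auto simp: l2_fin_def l2_def)
qed (auto simp: l2_fin_def)

lemma l2_finE:
  assumes "u \<in> l2_fin"
  obtains n where "\<forall>k\<ge>n. u k = 0"
proof -
  from assms obtain n where "\<forall>k\<in>{k. u k \<noteq> 0}. k < n"
    unfolding l2_fin_iff_finite finite_nat_set_iff_bounded by blast
  then show thesis
    by (intro that[of n]) (auto simp: not_le[symmetric])
qed

lemma l2_finI: "\<forall>k\<ge>n. u k = 0 \<Longrightarrow> u \<in> l2_fin"
  unfolding l2_fin_iff_finite
  by (rule finite_subset[of _ "{..<n}"]) (auto simp: not_le[symmetric])

section \<open>The Jacobi matrix as multiplication by the variable\<close>

lemma jacobi_matrix_commute: "jacobi_matrix a b i j = jacobi_matrix a b j i"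
  by (auto simp: jacobi_matrix_def)

lemma mat_vec_eq_sum:
  assumes "\<forall>k\<ge>n. u k = 0"
  shows "mat_vec A u i = (\<Sum>j<n. A i j * u j)"
  unfolding mat_vec_def by (rule suminf_finite) (use assms in auto)

text \<open>Row i of the tridiagonal J meets only columns i-1, i, i+1, so J lengthens a vector by at
  most one entry.\<close>

lemma mat_vec_jacobi_eq_0:
  assumes "\<forall>k\<ge>n. u k = 0" and "i \<ge> Suc n"
  shows "mat_vec (jacobi_matrix a b) u i = 0"
  unfolding mat_vec_eq_sum[OF assms(1)]
  by (rule sum.neutral) (use assms(2) in \<open>auto simp: jacobi_matrix_def\<close>)

lemma mat_vec_jacobi_l2_fin: "u \<in> l2_fin \<Longrightarrow> mat_vec (jacobi_matrix a b) u \<in> l2_fin"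
  by (elim l2_finE, rule l2_finI) (blast intro: mat_vec_jacobi_eq_0)

text \<open>The three-term recurrence is column j of J applied to the p_i. The column ends in row
  j+1, which the bound on N includes.\<close>

lemma jacobi_polys_column:
  assumes "jacobi_polys a b p" and "Suc j < N"
  shows "(\<Sum>i<N. smult (jacobi_matrix a b i j) (p i)) = pCons 0 (p j)"
proof -
  have "poly (\<Sum>i<N. smult (jacobi_matrix a b i j) (p i)) x = poly (pCons 0 (p j)) x" for x
  proof -
    let ?f = "\<lambda>i. jacobi_matrix a b i j * poly (p i) x"
    \<comment> \<open>For j = 0 there is no row above the diagonal; the empty set matches the
      convention a_{-1} = 0.\<close>
    let ?S = "(case j of 0 \<Rightarrow> {} | Suc m \<Rightarrow> {m}) \<union> {j, Suc j}"
    have "poly (\<Sum>i<N. smult (jacobi_matrix a b i j) (p i)) x = sum ?f {..<N}"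
      by (simp add: poly_sum)
    also have "\<dots> = sum ?f ?S"
      by (rule sum.mono_neutral_right)
        (use assms(2) in \<open>auto simp: jacobi_matrix_def split: nat.splits\<close>)
    also have "\<dots> = (case j of 0 \<Rightarrow> 0 | Suc m \<Rightarrow> a m * poly (p m) x)
              + b j * poly (p j) x + a j * poly (p (Suc j)) x"
      by (auto simp: jacobi_matrix_def split: nat.split)
    also have "\<dots> = x * poly (p j) x"
      using assms(1) by (simp add: jacobi_polys_def)
    finally show ?thesis by simp
  qed
  then show ?thesis
    by (simp add: poly_eq_poly_eq_iff[symmetric] fun_eq_iff)
qed

text \<open>Swapping the double sum groups it by columns of J, and column j contributes u_j x
  p_j.\<close>

lemma poly_expansion_mat_vec:
  assumes "jacobi_polys a b p" and "u \<in> l2_fin"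
  shows "poly_expansion p (mat_vec (jacobi_matrix a b) u) = pCons 0 (poly_expansion p u)"
proof -
  let ?J = "jacobi_matrix a b"
  obtain n where n: "\<forall>k\<ge>n. u k = 0"
    using assms(2) by (rule l2_finE) blast
  have "poly_expansion p (mat_vec ?J u) = (\<Sum>i<Suc n. smult (mat_vec ?J u i) (p i))"
    by (rule poly_expansion_eq_sum) (blast intro: mat_vec_jacobi_eq_0[OF n])
  also have "\<dots> = (\<Sum>i<Suc n. \<Sum>j<n. smult (u j) (smult (?J i j) (p i)))"
    unfolding mat_vec_eq_sum[OF n] by (simp add: smult_sum mult.commute del: sum.lessThan_Suc)
  also have "\<dots> = (\<Sum>j<n. smult (u j) (\<Sum>i<Suc n. smult (?J i j) (p i)))"
    by (subst sum.swap) (simp only: smult_sum_right)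
  also have "\<dots> = (\<Sum>j<n. smult (u j) (pCons 0 (p j)))"
    by (rule sum.cong) (simp_all del: sum.lessThan_Suc add: jacobi_polys_column[OF assms(1)])
  \<comment> \<open>\<open>pCons 0 1\<close> is the variable x, written as a factor so that it can
    leave the sum.\<close>
  also have "\<dots> = pCons 0 1 * (\<Sum>j<n. smult (u j) (p j))"
    by (simp add: sum_distrib_left)
  also have "\<dots> = pCons 0 (poly_expansion p u)"
    using poly_expansion_eq_sum[OF n, of p] by simp
  finally show ?thesis .
qed

text \<open>Horner's scheme: if u expands to q, then J u expands to x q, and adding c to entry 0
  adds c p_0 = c.\<close>

lemma poly_expansion_surj:
  assumes "jacobi_polys a b p"
  shows "\<exists>u\<in>l2_fin. poly_expansion p u = q"
proof (induction q)
  case 0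
  have "(\<lambda>_. 0) \<in> l2_fin" by (rule l2_finI) simp
  then show ?case by (rule bexI[rotated]) (simp add: poly_expansion_def)
next
  case (pCons c q)
  then obtain u where u: "u \<in> l2_fin" "poly_expansion p u = q" by blast
  define v where "v = mat_vec (jacobi_matrix a b) u"
  have "v \<in> l2_fin"
    unfolding v_def using u(1) by (rule mat_vec_jacobi_l2_fin)
  then obtain n where n: "\<forall>k\<ge>n. v k = 0" by (rule l2_finE) blast
  define w where "w = v(0 := v 0 + c)"
  \<comment> \<open>The bound is \<open>Suc n\<close> because n may be 0, while the altered entry 0
    must lie in the range.\<close>
  have w0: "\<forall>k\<ge>Suc n. w k = 0"
    using n by (simp add: w_def)
  have "poly_expansion p w = (\<Sum>k<Suc n. smult (w k) (p k))"
    by (rule poly_expansion_eq_sum) (rule w0)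
  also have "\<dots> = (\<Sum>k<Suc n. smult (v k) (p k)) + smult c (p 0)"
    by (simp add: sum.lessThan_Suc_shift w_def smult_add_left del: sum.lessThan_Suc)
  also have "(\<Sum>k<Suc n. smult (v k) (p k)) = poly_expansion p v"
    by (rule poly_expansion_eq_sum[symmetric]) (simp add: n)
  also have "\<dots> = pCons 0 q"
    using poly_expansion_mat_vec[OF assms u(1)] u(2) by (simp add: v_def)
  also have "pCons 0 q + smult c (p 0) = pCons c q"
    using assms by (simp add: jacobi_polys_def one_pCons)
  finally show ?case
    using l2_finI[OF w0] by blast
qed

section \<open>The spectral function in terms of S\<close>

lemma spectral_function_hom:
  assumes "spectral_function p \<sigma>"
  shows "module_hom smult (*) (\<lambda>q. \<sigma> q r)" and "module_hom smult (*) (\<sigma> q)"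
proof -
  have *: "Vector_Spaces.linear smult (*) (\<lambda>q. \<sigma> q r)" "Vector_Spaces.linear smult (*) (\<sigma> q)"
    using assms by (auto simp: spectral_function_def)
  show "module_hom smult (*) (\<lambda>q. \<sigma> q r)" and "module_hom smult (*) (\<sigma> q)"
    by (rule *[THEN Vector_Spaces.linear.axioms(3)])+
qed

lemma spectral_function_sum:
  assumes "spectral_function p \<sigma>"
  shows "\<sigma> (\<Sum>i\<in>I. smult (c i) (f i)) r = (\<Sum>i\<in>I. c i * \<sigma> (f i) r)"
    and "\<sigma> q (\<Sum>i\<in>I. smult (c i) (f i)) = (\<Sum>i\<in>I. c i * \<sigma> q (f i))"
  using assms
  by (simp_all add: module_hom.sum[OF spectral_function_hom(1)]
      module_hom.scale[OF spectral_function_hom(1)]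
      module_hom.sum[OF spectral_function_hom(2)] module_hom.scale[OF spectral_function_hom(2)])

text \<open>Orthonormality of the p_k lets pairing with p_m pick out one coefficient.\<close>

lemma spectral_function_expansion:
  assumes "spectral_function p \<sigma>" and "u \<in> l2_fin"
  shows "\<sigma> (poly_expansion p u) (p m) = u m"
proof -
  have "\<sigma> (p k) (p m) = (if k = m then 1 else 0)" for k
    using assms(1) by (simp add: spectral_function_def)
  moreover have "finite {k. u k \<noteq> 0}"
    using assms(2) by (simp add: l2_fin_iff_finite)
  ultimately show ?thesis
    by (simp only: poly_expansion_def spectral_function_sum(1)[OF assms(1)])
      (simp add: if_distrib[of "\<lambda>x. _ * x"] cong: if_cong)
qed

text \<open>On basis polynomials p_j, p_m the two sides are the entries (m, j) and (j, m) of the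
  symmetric J. Bilinearity and surjectivity of the expansion extend this to all q and r.\<close>

lemma spectral_function_shift:
  assumes "jacobi_polys a b p" and "spectral_function p \<sigma>"
  shows "\<sigma> (pCons 0 q) r = \<sigma> q (pCons 0 r)"
proof -
  let ?J = "jacobi_matrix a b"
  have \<sigma>: "\<sigma> (p n) (p m) = (if n = m then 1 else 0)" for n m
    using assms(2) by (simp add: spectral_function_def)
  have left: "\<sigma> (pCons 0 (p j)) (p m) = ?J m j" for j m
  proof -
    \<comment> \<open>The bound j+m+2 exceeds both j+1, as the column identity demands, and m, the
      one index that survives orthonormality.\<close>
    have "\<sigma> (pCons 0 (p j)) (p m) = (\<Sum>i<Suc (Suc (j + m)). ?J i j * \<sigma> (p i) (p m))"
      by (subst jacobi_polys_column[OF assms(1), of j "Suc (Suc (j + m))", symmetric], simp)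
        (rule spectral_function_sum(1)[OF assms(2)])
    then show ?thesis
      by (simp add: \<sigma> if_distrib cong: if_cong del: sum.lessThan_Suc)
  qed
  have right: "\<sigma> (p j) (pCons 0 (p m)) = ?J j m" for j m
  proof -
    have "\<sigma> (p j) (pCons 0 (p m)) = (\<Sum>i<Suc (Suc (j + m)). ?J i m * \<sigma> (p j) (p i))"
      by (subst jacobi_polys_column[OF assms(1), of m "Suc (Suc (j + m))", symmetric], simp)
        (rule spectral_function_sum(2)[OF assms(2)])
    then show ?thesis
      by (simp add: \<sigma> if_distrib cong: if_cong del: sum.lessThan_Suc)
  qed
  obtain u v where q: "q = poly_expansion p u" and r: "r = poly_expansion p v"
    using poly_expansion_surj[OF assms(1)] by metis
  have shift: "pCons 0 (poly_expansion p w) = (\<Sum>k | w k \<noteq> 0. smult (w k) (pCons 0 (p k)))" for w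
  proof -
    have "pCons 0 (poly_expansion p w) = pCons 0 1 * poly_expansion p w"
      by simp
    also have "\<dots> = (\<Sum>k | w k \<noteq> 0. smult (w k) (pCons 0 (p k)))"
      unfolding poly_expansion_def by (subst sum_distrib_left) simp
    finally show ?thesis .
  qed
  show ?thesis
    \<comment> \<open>Once x is moved inside the sums, both sides are the same double sum up to
      transposing J.\<close>
    unfolding q r shift
    unfolding poly_expansion_def spectral_function_sum[OF assms(2)] left right
    by (simp add: jacobi_matrix_commute)
qed

text \<open>Writing the second argument as c + x r, the factor x passes to q, and the induction
  hypothesis is applied to x q; hence q is arbitrary.\<close>

lemma spectral_function_eq_assoc_functional:
  assumes "jacobi_polys a b p" and "spectral_function p \<sigma>"
  shows "\<sigma> q r = assoc_functional \<sigma> (q * r)"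
proof (induction r arbitrary: q)
  case 0
  show ?case
    using assms(2)
    by (simp add: assoc_functional_def module_hom.zero[OF spectral_function_hom(1)]
        module_hom.zero[OF spectral_function_hom(2)])
next
  case (pCons c r)
  note hom = spectral_function_hom[OF assms(2)]
  have "\<sigma> q (pCons c r) = \<sigma> q (smult c 1 + pCons 0 r)"
    by (simp add: one_pCons)
  also have "\<dots> = c * \<sigma> q 1 + \<sigma> (pCons 0 q) r"
    by (simp only: module_hom.add[OF hom(2)] module_hom.scale[OF hom(2)]
        spectral_function_shift[OF assms])
  also have "\<dots> = \<sigma> (smult c q + pCons 0 q * r) 1"
    by (simp only: pCons.IH assoc_functional_def module_hom.add[OF hom(1)]
        module_hom.scale[OF hom(1)])
  also have "smult c q + pCons 0 q * r = q * pCons c r"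
    by simp
  finally show ?case by (simp add: assoc_functional_def)
qed

section \<open>Square integrability and classes in L^2\<close>

lemma AE_in_measure_support:
  fixes \<mu> :: "'a::second_countable_topology measure"
  assumes sets: "sets \<mu> = sets borel"
  shows "AE z in \<mu>. z \<in> measure_support \<mu>"
proof -
  define F where "F = {U. open U \<and> emeasure \<mu> U = 0}"
  \<comment> \<open>The complement of the support is the union of all open null sets; second
    countability reduces it to a countable union, hence a null set.\<close>
  obtain G where G: "G \<subseteq> F" "countable G" "\<Union>G = \<Union>F"
    by (rule Lindelof[of F]) (auto simp: F_def)
  have "(\<Union>U\<in>G. U) \<in> null_sets \<mu>"
    by (rule null_sets_UN'[OF G(2)]) (use G(1) sets in \<open>auto simp: F_def null_sets_def\<close>)
  moreover have "{z \<in> space \<mu>. z \<notin> measure_support \<mu>} \<subseteq> \<Union>F"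
    by (auto simp: measure_support_def F_def)
  ultimately show ?thesis
    using G(3) by (intro AE_I'[of "\<Union>G"]) auto
qed

text \<open>A continuous f is bounded on the compact support, which carries almost all of the finite
  measure.\<close>

lemma continuous_in_L2_fun:
  assumes sets: "sets \<mu> = sets borel" and "compact (measure_support \<mu>)"
    and fin: "emeasure \<mu> (space \<mu>) < \<infinity>" and f: "continuous_on UNIV f"
  shows "f \<in> L2_fun \<mu>"
proof -
  have "compact (f ` measure_support \<mu>)"
    by (rule compact_continuous_image[OF continuous_on_subset[OF f] assms(2)]) simp
  then obtain B where B: "\<And>z. z \<in> measure_support \<mu> \<Longrightarrow> norm (f z) \<le> B"
    using bounded_iff[of "f ` measure_support \<mu>"] compact_imp_bounded by blast
  have "(\<integral>\<^sup>+z. ennreal ((norm (f z))\<^sup>2) \<partial>\<mu>) \<le> (\<integral>\<^sup>+z. ennreal (B\<^sup>2) \<partial>\<mu>)"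
  proof (rule nn_integral_mono_AE)
    show "AE z in \<mu>. ennreal ((norm (f z))\<^sup>2) \<le> ennreal (B\<^sup>2)"
      using AE_in_measure_support[OF sets]
      by eventually_elim (intro ennreal_leI power_mono B norm_ge_zero)
  qed
  also have "\<dots> < \<infinity>"
    using fin by (simp add: ennreal_mult_less_top)
  finally show ?thesis
    using f by (simp add: L2_fun_def borel_measurable_continuous_onI)
qed

lemma equiv_L2_rel: "equiv (L2_fun \<mu>) (L2_rel \<mu>)"
proof (rule equivI)
  show "trans (L2_rel \<mu>)"
  proof (rule transI)
    fix f g h assume "(f, g) \<in> L2_rel \<mu>" "(g, h) \<in> L2_rel \<mu>"
    moreover from this have "AE z in \<mu>. f z = g z" "AE z in \<mu>. g z = h z"
      by (auto simp: L2_rel_def)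
    then have "AE z in \<mu>. f z = h z"
      by eventually_elim simp
    ultimately show "(f, h) \<in> L2_rel \<mu>"
      by (auto simp: L2_rel_def)
  qed
qed (auto simp: L2_rel_def refl_on_def sym_def eq_commute)

lemma L2_class_eq_iff:
  assumes "f \<in> L2_fun \<mu>" and "g \<in> L2_fun \<mu>"
  shows "L2_class \<mu> f = L2_class \<mu> g \<longleftrightarrow> (AE z in \<mu>. f z = g z)"
  unfolding L2_class_def
  using eq_equiv_class_iff[OF equiv_L2_rel assms] assms by (simp add: L2_rel_def)

section \<open>The operator T and the main equality\<close>

lemma T_map_eq: "T_map p \<mu> u = L2_class \<mu> (poly (poly_expansion p u))"
  unfolding T_map_def poly_expansion_def
  by (rule arg_cong[of _ _ "L2_class \<mu>"]) (simp add: poly_sum fun_eq_iff)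

lemma T_map_mat_vec:
  assumes "jacobi_polys a b p" and "u \<in> l2_fin"
  shows "T_map p \<mu> (mat_vec (jacobi_matrix a b) u) =
         L2_class \<mu> (\<lambda>z. z * poly (poly_expansion p u) z)"
proof -
  have "poly (pCons 0 q) = (\<lambda>z. z * poly q z)" for q :: "complex poly"
    by (simp add: fun_eq_iff)
  then show ?thesis
    by (simp add: T_map_eq poly_expansion_mat_vec[OF assms])
qed

lemma inj_on_T_map:
  assumes "jacobi_polys a b p" and "spectral_function p \<sigma>"
    and S: "\<And>q. assoc_functional \<sigma> q = (\<integral>z. poly q z \<partial>\<mu>)"
    and sets: "sets \<mu> = sets borel" and L2: "\<And>q. poly q \<in> L2_fun \<mu>"
  shows "inj_on (T_map p \<mu>) l2_fin"
proof (rule inj_onI)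
  fix u v assume u: "u \<in> l2_fin" and v: "v \<in> l2_fin" and eq: "T_map p \<mu> u = T_map p \<mu> v"
  have ae: "AE z in \<mu>. poly (poly_expansion p u) z = poly (poly_expansion p v) z"
    using eq by (simp add: T_map_eq L2_class_eq_iff L2)
  have meas: "poly q \<in> borel_measurable \<mu>" for q :: "complex poly"
    using L2[of q] measurable_cong_sets[OF sets refl] by (auto simp: L2_fun_def)
  show "u = v"
  proof
    fix m
    have "\<sigma> (poly_expansion p u) (p m) = (\<integral>z. poly (poly_expansion p u * p m) z \<partial>\<mu>)"
      by (simp only: spectral_function_eq_assoc_functional[OF assms(1,2)] S)
    also have "\<dots> = (\<integral>z. poly (poly_expansion p v * p m) z \<partial>\<mu>)"
      \<comment> \<open>The product with p_m keeps the a.e. equality, and both integrands are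
        measurable as polynomials.\<close>
      by (intro integral_cong_AE meas) (use ae in \<open>eventually_elim, simp\<close>)
    also have "\<dots> = \<sigma> (poly_expansion p v) (p m)"
      by (simp only: spectral_function_eq_assoc_functional[OF assms(1,2)] S)
    finally show "u m = v m"
      by (simp add: spectral_function_expansion[OF assms(2)] u v)
  qed
qed

theorem corollary2:
  fixes a b :: "nat \<Rightarrow> complex"
    and p :: "nat \<Rightarrow> complex poly"
    and \<sigma> :: "complex poly \<Rightarrow> complex poly \<Rightarrow> complex"
    and M :: real
    and \<mu> :: "complex measure"
  assumes "\<And>k. a k \<noteq> 0"
    and "jacobi_polys a b p"
    and "spectral_function p \<sigma>"
    and "M > 0"
    and "\<And>k. norm (a k) \<le> M"
    and "\<And>k. norm (b k) \<le> M"
    and "sets \<mu> = sets borel"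
    and "compact (measure_support \<mu>)"
    and "\<And>q. assoc_functional \<sigma> q = (\<integral>z. poly q z \<partial>\<mu>)"
  shows "inj_on (T_map p \<mu>) l2_fin \<and>
         (T_op p \<mu>)\<inverse> O A0_op a b O T_op p \<mu> = op_restrict (mult_op \<mu>) (L2_polys \<mu>)"
proof
  note J = \<open>jacobi_polys a b p\<close> and \<sigma> = \<open>spectral_function p \<sigma>\<close>
    and sets = \<open>sets \<mu> = sets borel\<close>
  let ?J = "mat_vec (jacobi_matrix a b)"
  \<comment> \<open>S(1) = sigma(p_0, p_0) = 1 is the total mass of mu; finiteness of mu is
    extracted from it.\<close>
  have "p 0 = 1"
    using J by (simp add: jacobi_polys_def)
  moreover have "\<sigma> (p 0) (p 0) = 1"
    using \<sigma> by (simp add: spectral_function_def)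
  ultimately have "complex_of_real (measure \<mu> (space \<mu>)) = 1"
    using assms(9)[of 1] by (simp add: assoc_functional_def scaleR_conv_of_real)
  \<comment> \<open>An infinite \<open>emeasure\<close> would give \<open>measure \<mu> (space \<mu>) = 0\<close>.\<close>
  then have fin: "emeasure \<mu> (space \<mu>) < \<infinity>"
    by (auto simp: measure_def less_top)
  have L2: "poly q \<in> L2_fun \<mu>" for q
    by (rule continuous_in_L2_fun[OF sets assms(8) fin]) (intro continuous_intros)
  have L2_mult: "(\<lambda>z. z * poly q z) \<in> L2_fun \<mu>" for q
    by (rule continuous_in_L2_fun[OF sets assms(8) fin]) (intro continuous_intros)
  show "inj_on (T_map p \<mu>) l2_fin"
    by (rule inj_on_T_map[OF J \<sigma> assms(9) sets L2])
  have "(T_op p \<mu>)\<inverse> O A0_op a b O T_op p \<mu> = {(T_map p \<mu> u, T_map p \<mu> (?J u)) | u. u \<in> l2_fin}"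
  proof -
    have T: "(x, y) \<in> T_op p \<mu> \<longleftrightarrow> x \<in> l2_fin \<and> y = T_map p \<mu> x"
      and A: "(x, z) \<in> A0_op a b \<longleftrightarrow> x \<in> l2_fin \<and> z = ?J x" for x y z
      by (auto simp: T_op_def A0_op_def op_on_def)
    show ?thesis
      \<comment> \<open>J u has to lie in the domain of T again, or the composite would lose the
        pair that starts at T u.\<close>
      using mat_vec_jacobi_l2_fin by (auto simp: T A relcomp_unfold)
  qed
  also have "\<dots> = {(L2_class \<mu> (poly q), L2_class \<mu> (\<lambda>z. z * poly q z)) | q. True}"
  proof -
    have "{(T_map p \<mu> u, T_map p \<mu> (?J u)) | u. u \<in> l2_fin} =
        (\<lambda>q. (L2_class \<mu> (poly q), L2_class \<mu> (\<lambda>z. z * poly q z))) ` poly_expansion p ` l2_fin"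
      unfolding Setcompr_eq_image image_image
      by (rule image_cong) (simp_all only: T_map_mat_vec[OF J], simp only: T_map_eq)
    also have "poly_expansion p ` l2_fin = UNIV"
      by (metis UNIV_eq_I image_eqI poly_expansion_surj[OF J])
    finally show ?thesis by auto
  qed
  also have "\<dots> = op_restrict (mult_op \<mu>) (L2_polys \<mu>)"
  proof (intro equalityI subsetI)
    fix x assume "x \<in> op_restrict (mult_op \<mu>) (L2_polys \<mu>)"
    then obtain f q where x: "x = (L2_class \<mu> f, L2_class \<mu> (\<lambda>z. z * f z))"
      and f: "f \<in> L2_fun \<mu>" "(\<lambda>z. z * f z) \<in> L2_fun \<mu>" and q: "L2_class \<mu> f = L2_class \<mu> (poly q)"
      by (auto simp: op_restrict_def mult_op_def L2_polys_def)
    \<comment> \<open>The representative f of a polynomial class need not be a polynomial, so its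
      product with z is compared almost everywhere.\<close>
    have "AE z in \<mu>. f z = poly q z"
      using q by (simp add: L2_class_eq_iff f L2)
    then have "AE z in \<mu>. z * f z = z * poly q z"
      by eventually_elim simp
    then have "L2_class \<mu> (\<lambda>z. z * f z) = L2_class \<mu> (\<lambda>z. z * poly q z)"
      by (simp add: L2_class_eq_iff f L2_mult)
    then show "x \<in> {(L2_class \<mu> (poly q), L2_class \<mu> (\<lambda>z. z * poly q z)) | q. True}"
      using x q by auto
  next
    fix x assume "x \<in> {(L2_class \<mu> (poly q), L2_class \<mu> (\<lambda>z. z * poly q z)) | q. True}"
    then obtain q where x: "x = (L2_class \<mu> (poly q), L2_class \<mu> (\<lambda>z. z * poly q z))"
      by blast
    \<comment> \<open>Polynomial classes lie in the maximal domain, so the restricted operator is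
      defined on all of them.\<close>
    moreover have "x \<in> mult_op \<mu>"
      unfolding x mult_op_def using L2 L2_mult by blast
    ultimately show "x \<in> op_restrict (mult_op \<mu>) (L2_polys \<mu>)"
      by (simp add: op_restrict_def L2_polys_def)
  qed
  finally show "(T_op p \<mu>)\<inverse> O A0_op a b O T_op p \<mu> = op_restrict (mult_op \<mu>) (L2_polys \<mu>)" .
qed

end
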